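(* Let $m\ge1$ be an integer, $t_1,\dots,t_m\in\mathbb{R}$ with $t_m>0$, and $\lambda>-1$. For every $n\ge1$, the recurrence coefficient $\beta_n=\beta_n(T_m;\lambda)$ satisfies $$\sum_{k=1}^{m}2kt_k\frac{\partial\ln\beta_n}{\partial t_k}+2=0.$$
   Context: Let $T_m=(t_1,\dots,t_m)$ and $w(x;T_m;\lambda)=|x|^{2\lambda+1}\exp(-\sum_{k=1}^m t_kx^{2k})$ on $\mathbb{R}\setminus\{0\}$. $P_n(x;T_m;\lambda)$ is the monic polynomial of degree $n$ in the sequence orthogonal with respect to $w(x;T_m;\lambda)\,dx$ on $\mathbb{R}$; since $w$ is even, $xP_n=P_{n+1}+\beta_nP_{n-1}$ with $P_0=1$, $P_{-1}=0$, $\beta_0=0$, which defines $\beta_n=\beta_n(T_m;\lambda)$. *)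

theory Defs
  imports "HOL-Analysis.Analysis" "HOL-Computational_Algebra.Polynomial"
begin

(* Only the values t 1, ..., t m are used.  At x = 0 the library convention
   0 powr a = 0 applies; this is a Lebesgue null set. *)
definition weight :: "nat \<Rightarrow> (nat \<Rightarrow> real) \<Rightarrow> real \<Rightarrow> real \<Rightarrow> real" where
  "weight m t lam x = \<bar>x\<bar> powr (2 * lam + 1) * exp (- (\<Sum>k=1..m. t k * x ^ (2 * k)))"

(* Integrability is required explicitly because the Bochner integral of a
   non-integrable function is 0, which would make orthogonality vacuous. *)
definition monic_orthogonal_seq :: "(real \<Rightarrow> real) \<Rightarrow> (nat \<Rightarrow> real poly) \<Rightarrow> bool" where
  "monic_orthogonal_seq w P \<longleftrightarrow>
     (\<forall>n. degree (P n) = n \<and> lead_coeff (P n) = 1) \<and>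
     (\<forall>i j. integrable lborel (\<lambda>x. poly (P i) x * poly (P j) x * w x)) \<and>
     (\<forall>i j. i \<noteq> j \<longrightarrow> (LINT x|lborel. poly (P i) x * poly (P j) x * w x) = 0) \<and>
     (\<forall>n. (LINT x|lborel. poly (P n) x * poly (P n) x * w x) > 0)"

definition monic_OP :: "(real \<Rightarrow> real) \<Rightarrow> nat \<Rightarrow> real poly" where
  "monic_OP w = (THE P. monic_orthogonal_seq w P)"

(* Coefficient of the recurrence x P_n = P_(n+1) + beta_n P_(n-1) for an even
   weight.  As P_(-1) = 0, the recurrence does not determine beta_0, which is
   set to 0. *)
definition rec_coeff :: "(real \<Rightarrow> real) \<Rightarrow> nat \<Rightarrow> real" where
  "rec_coeff w n =
     (if n = 0 then 0
      else (THE b. [:0, 1:] * monic_OP w n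
                     = monic_OP w (n + 1) + smult b (monic_OP w (n - 1))))"

definition beta :: "nat \<Rightarrow> (nat \<Rightarrow> real) \<Rightarrow> real \<Rightarrow> nat \<Rightarrow> real" where
  "beta m t lam n = rec_coeff (weight m t lam) n"

end

theory Submission
  imports Defs
begin

text \<open>
  Let \<open>h n\<close> be the integral of \<open>P n ^ 2 * w\<close>, so that \<open>\<beta> n = h n / h (n - 1)\<close>. Differentiating under
  the integral gives \<open>\<partial> h n / \<partial> t k = - \<integral> x ^ (2 k) * P n ^ 2 * w\<close>, because the variation of the monic
  polynomial \<open>P n\<close> has degree below \<open>n\<close> and is orthogonal to \<open>P n\<close>. Integrating the derivative of
  \<open>x * P n ^ 2 * w\<close> gives \<open>\<Sum>k. 2 k t k \<integral> x ^ (2 k) * P n ^ 2 * w = (2 lam + 2 + 2 n) * h n\<close>. Hence the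
  operator \<open>\<Sum>k. 2 k t k \<partial>/\<partial> t k\<close> maps \<open>ln (h n)\<close> to \<open>- (2 lam + 2 + 2 n)\<close> and \<open>ln (\<beta> n)\<close> to \<open>- 2\<close>.
\<close>

section \<open>Orthogonal polynomials of an even positive functional\<close>

text \<open>Isolates what the algebra uses of the map from \<open>p\<close> to the integral of
  \<open>p * w\<close>, so that neither the recurrence nor its dependence on a parameter mentions
  integrals. \<open>odd\<close> expresses evenness of the weight.\<close>

locale even_positive_functional =
  fixes L :: "real poly \<Rightarrow> real"
  assumes add: "L (p + q) = L p + L q"
    and smult: "L (smult c p) = c * L p"
    and odd: "pcompose p [:0, -1:] = - p \<Longrightarrow> L p = 0"
    and pos: "p \<noteq> 0 \<Longrightarrow> L (p * p) > 0"

text \<open>Built from the three-term recurrence with coefficient \<open>h (n + 1) / h n\<close>: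
  every coefficient is then an explicit expression in values of \<open>L\<close>, which can be
  differentiated by induction.\<close>

fun op_seq :: "(real poly \<Rightarrow> real) \<Rightarrow> nat \<Rightarrow> real poly" where
  "op_seq L 0 = 1"
| "op_seq L (Suc 0) = [:0, 1:]"
| "op_seq L (Suc (Suc n)) = [:0, 1:] * op_seq L (Suc n)
     - smult (L (op_seq L (Suc n) * op_seq L (Suc n)) / L (op_seq L n * op_seq L n)) (op_seq L n)"

lemma op_seq_monic: "degree (op_seq L n) = n \<and> lead_coeff (op_seq L n) = 1"
proof (induction L n rule: op_seq.induct)
  case (3 L n)
  let ?p = "[:0, 1:] * op_seq L (Suc n)"
  let ?q = "smult (L (op_seq L (Suc n) * op_seq L (Suc n)) / L (op_seq L n * op_seq L n)) (op_seq L n)"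
  have p: "degree ?p = Suc (Suc n)" "lead_coeff ?p = 1"
    using 3 by (auto simp: degree_mult_eq lead_coeff_mult)
  have q: "degree ?q < Suc (Suc n)"
    using 3 by (metis degree_smult_le le_imp_less_Suc lessI less_trans)
  have "degree (?p - ?q) = degree ?p"
    using p q by (metis degree_add_eq_left degree_minus diff_conv_add_uminus)
  moreover have "coeff ?q (Suc (Suc n)) = 0"
    using q by (rule coeff_eq_0)
  ultimately show ?case
    using p by (simp only: op_seq.simps coeff_diff) simp
qed auto

lemma degree_op_seq [simp]: "degree (op_seq L n) = n"
  and coeff_op_seq_degree [simp]: "coeff (op_seq L n) n = 1"
  using op_seq_monic[of L n] by auto

lemma op_seq_nonzero [simp]: "op_seq L n \<noteq> 0"
  using coeff_op_seq_degree[of L n] by (metis coeff_0 zero_neq_one)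

lemma op_seq_parity: "pcompose (op_seq L n) [:0, -1:] = smult ((-1) ^ n) (op_seq L n)"
  by (induction L n rule: op_seq.induct)
    (auto simp: pcompose_diff pcompose_mult pcompose_smult pcompose_pCons pcompose_1 algebra_simps
      smult_diff_right)

context even_positive_functional
begin

lemma zero [simp]: "L 0 = 0"
  using smult[of 0 0] by simp

lemma minus: "L (- p) = - L p"
  using smult[of "-1" p] by simp

lemma diff: "L (p - q) = L p - L q"
  using add[of p "- q"] by (simp add: minus)

lemma sum: "L (\<Sum>i\<in>A. f i) = (\<Sum>i\<in>A. L (f i))"
  by (induction A rule: infinite_finite_induct) (auto simp: add)

text \<open>Reduces \<open>L\<close> to finitely many moments; with a degree bound uniform in a
  parameter this is a finite sum that can be differentiated termwise.\<close>

lemma mult_eq_sum: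
  assumes "degree p \<le> N"
  shows "L (q * p) = (\<Sum>i\<le>N. coeff p i * L (q * monom 1 i))"
proof -
  have "L (q * p) = L (q * (\<Sum>i\<le>N. monom (coeff p i) i))"
    using poly_as_sum_of_monoms'[OF assms] by simp
  also have "\<dots> = (\<Sum>i\<le>N. L (smult (coeff p i) (q * monom 1 i)))"
    by (simp add: sum_distrib_left sum smult_monom flip: mult_smult_right)
  finally show ?thesis by (simp add: smult)
qed

text \<open>Stripping the top coefficient with \<open>P n\<close> gives an induction on
  \<open>n\<close>. Vanishing coefficients express degree below \<open>n\<close> and also cover
  \<open>n = 0\<close>, where \<open>p = 0\<close>. \<open>P\<close> is arbitrary because uniqueness
  applies this to a competing sequence.\<close>

lemma orthogonal_lower:
  assumes "\<And>j. degree (P j) = j" "\<And>j. lead_coeff (P j) = 1"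
    and "\<And>j. j < n \<Longrightarrow> L (q * P j) = 0"
    and "\<And>i. i \<ge> n \<Longrightarrow> coeff p i = 0"
  shows "L (q * p) = 0"
  using assms(3,4)
proof (induction n arbitrary: p)
  case 0
  then have "p = 0" by (intro poly_eqI) auto
  then show ?case by simp
next
  case (Suc n)
  define r where "r = p - smult (coeff p n) (P n)"
  have "coeff r i = 0" if "i \<ge> n" for i
  proof (cases "i = n")
    case True
    then show ?thesis using assms(1,2)[of n] by (simp add: r_def)
  next
    case False
    then show ?thesis
      using that Suc.prems(2)[of i] assms(1)[of n] by (simp add: r_def coeff_eq_0)
  qed
  then have "L (q * r) = 0"
    using Suc.IH Suc.prems(1) by simp
  moreover have "q * p = q * r + smult (coeff p n) (q * P n)"
    by (simp add: r_def algebra_simps)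
  ultimately show ?case
    using Suc.prems(1)[of n] by (simp add: add smult)
qed

lemma op_seq_orthogonal_parity:
  assumes "odd (i + j)"
  shows "L (op_seq L i * op_seq L j) = 0"
proof (rule odd)
  have "(-1) ^ i * (-1) ^ j = (-1 :: real)"
    using assms by (simp flip: power_add)
  then show "pcompose (op_seq L i * op_seq L j) [:0, -1:] = - (op_seq L i * op_seq L j)"
    by (simp add: pcompose_mult op_seq_parity mult.commute)
qed

lemma X_mult_op_seq:
  "[:0, 1:] * op_seq L j = op_seq L (Suc j)
     + (if j = 0 then 0 else smult (L (op_seq L j * op_seq L j) / L (op_seq L (j - 1) * op_seq L (j - 1)))
          (op_seq L (j - 1)))"
  by (cases j) auto

text \<open>Strong induction: the recurrence lowers \<open>n\<close>, and the factor
  \<open>x\<close> is moved onto \<open>op_seq L j\<close>, where the recurrence applies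
  again.\<close>

lemma op_seq_orthogonal_less: "j < n \<Longrightarrow> L (op_seq L n * op_seq L j) = 0"
proof (induction n arbitrary: j rule: less_induct)
  case (less n)
  \<comment> \<open>Parity disposes of \<open>j = n - 1\<close>, so the remaining case has
    \<open>j\<close> at most \<open>n - 2\<close>.\<close>
  consider "odd (n + j)" | m where "n = Suc (Suc m)" "j \<le> m" "even (n + j)"
    using less.prems by (cases n; cases "n - 1") (auto simp: less_Suc_eq_le le_Suc_eq)
  then show ?case
  proof cases
    case 1
    then show ?thesis by (rule op_seq_orthogonal_parity)
  next
    case (2 m)
    let ?h = "\<lambda>i. L (op_seq L i * op_seq L i)"
    have "op_seq L n * op_seq L j = op_seq L (Suc m) * ([:0, 1:] * op_seq L j)
        - smult (?h (Suc m) / ?h m) (op_seq L m * op_seq L j)"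
      by (simp add: 2 algebra_simps)
    then have *: "L (op_seq L n * op_seq L j) = L (op_seq L (Suc m) * ([:0, 1:] * op_seq L j))
        - ?h (Suc m) / ?h m * L (op_seq L m * op_seq L j)"
      by (simp only: diff smult)
    \<comment> \<open>The other term pairs indices \<open>Suc m\<close> and \<open>j - 1\<close>,
      hence vanishes by induction.\<close>
    have **: "L (op_seq L (Suc m) * ([:0, 1:] * op_seq L j)) = L (op_seq L (Suc m) * op_seq L (Suc j))"
      using less.IH[of "Suc m" "j - 1"] 2
      by (subst X_mult_op_seq) (auto simp: algebra_simps add smult)
    \<comment> \<open>For \<open>j = m\<close> the coefficient \<open>?h (Suc m) / ?h m\<close>
      makes the two terms cancel; for \<open>j < m\<close> both vanish by induction.\<close>
    show ?thesis
    proof (cases "j = m")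
      case True
      then show ?thesis using * ** pos[of "op_seq L m"] by simp
    next
      case False
      then show ?thesis
        using * ** less.IH[of "Suc m" "Suc j"] less.IH[of m j] 2 by simp
    qed
  qed
qed

lemma op_seq_orthogonal_lower:
  assumes "\<And>i. i \<ge> n \<Longrightarrow> coeff p i = 0"
  shows "L (op_seq L n * p) = 0"
  using orthogonal_lower[of "op_seq L" n, OF _ _ op_seq_orthogonal_less assms] by simp

lemma op_seq_orthogonal:
  assumes "i \<noteq> j"
  shows "L (op_seq L i * op_seq L j) = 0"
  using assms op_seq_orthogonal_less[of i j] op_seq_orthogonal_less[of j i]
  by (cases i j rule: linorder_cases) (auto simp: mult.commute)

text \<open>The difference of two monic candidates of degree \<open>n\<close> has lower degree, so
  it is orthogonal to both, hence to itself, and positivity makes it zero.\<close>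

lemma op_seq_unique:
  assumes "\<And>j. degree (P j) = j" "\<And>j. lead_coeff (P j) = 1"
    and "\<And>i j. i \<noteq> j \<Longrightarrow> L (P i * P j) = 0"
  shows "P = op_seq L"
proof
  fix n
  define d where "d = P n - op_seq L n"
  have d: "coeff d i = 0" if "i \<ge> n" for i
  proof (cases "i = n")
    case True
    then show ?thesis using assms(1,2)[of n] by (simp add: d_def)
  next
    case False
    then show ?thesis using that assms(1)[of n] by (simp add: d_def coeff_eq_0)
  qed
  have "L (P n * d) = 0"
    by (rule orthogonal_lower[of P n, OF assms(1,2) _ d]) (use assms(3) in auto)
  moreover have "L (op_seq L n * d) = 0"
    by (rule op_seq_orthogonal_lower[OF d])
  moreover have "d * d = P n * d - op_seq L n * d"
    by (simp add: d_def algebra_simps)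
  ultimately have "L (d * d) = 0"
    by (simp add: diff)
  then have "d = 0"
    using pos[of d] by force
  then show "P n = op_seq L n"
    by (simp add: d_def)
qed

end

section \<open>Dependence on a parameter\<close>

text \<open>Coefficientwise derivative of a curve of polynomials; the uniform degree bound enters
  separately, in \<open>functional_has_deriv\<close>.\<close>

definition poly_has_deriv :: "(real \<Rightarrow> real poly) \<Rightarrow> real poly \<Rightarrow> real \<Rightarrow> bool" where
  "poly_has_deriv P D s \<longleftrightarrow> (\<forall>i. ((\<lambda>s. coeff (P s) i) has_real_derivative coeff D i) (at s))"

lemma poly_has_deriv_const: "poly_has_deriv (\<lambda>_. p) 0 s"
  by (simp add: poly_has_deriv_def)

lemma poly_has_deriv_diff:
  assumes "poly_has_deriv P D s" "poly_has_deriv Q E s"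
  shows "poly_has_deriv (\<lambda>s. P s - Q s) (D - E) s"
  using assms unfolding poly_has_deriv_def by (auto intro!: derivative_intros)

lemma poly_has_deriv_mult:
  assumes "poly_has_deriv P D s" "poly_has_deriv Q E s"
  shows "poly_has_deriv (\<lambda>s. P s * Q s) (D * Q s + P s * E) s"
  unfolding poly_has_deriv_def
proof
  fix n
  have "((\<lambda>s. \<Sum>i\<le>n. coeff (P s) i * coeff (Q s) (n - i)) has_real_derivative
      (\<Sum>i\<le>n. coeff D i * coeff (Q s) (n - i) + coeff E (n - i) * coeff (P s) i)) (at s)"
    using assms unfolding poly_has_deriv_def
    by (intro DERIV_sum DERIV_mult) auto
  then show "((\<lambda>s. coeff (P s * Q s) n) has_real_derivative coeff (D * Q s + P s * E) n) (at s)"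
    by (simp add: coeff_mult sum.distrib mult.commute[of "coeff E _"])
qed

lemma poly_has_deriv_smult:
  assumes "(c has_real_derivative c') (at s)" "poly_has_deriv Q E s"
  shows "poly_has_deriv (\<lambda>s. smult (c s) (Q s)) (smult c' (Q s) + smult (c s) E) s"
  using assms unfolding poly_has_deriv_def
  by (auto intro!: derivative_eq_intros)

text \<open>Product rule where both functional and argument move. For the weight, \<open>r\<close>
  will be \<open>x ^ (2 * k)\<close>, brought down from the exponential. Being a positive functional
  is asked only near \<open>s0\<close>, since \<open>t m > 0\<close> must survive the
  variation.\<close>

lemma functional_has_deriv:
  assumes L: "eventually (\<lambda>s. even_positive_functional (L s)) (nhds s0)"
    and L': "\<And>p. ((\<lambda>s. L s p) has_real_derivative - L s0 (r * p)) (at s0)"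
    and P: "poly_has_deriv P D s0" and deg: "\<And>s. degree (P s) \<le> N"
  shows "((\<lambda>s. L s (P s)) has_real_derivative L s0 D - L s0 (r * P s0)) (at s0)"
proof -
  interpret even_positive_functional "L s0"
    using L by (rule eventually_nhds_x_imp_x)
  \<comment> \<open>Above the degree bound a constant zero coefficient is differentiated.\<close>
  have "coeff D i = 0" if "i > N" for i
  proof -
    have "(\<lambda>s. coeff (P s) i) = (\<lambda>_. 0)"
      using deg that by (intro ext coeff_eq_0) (meson le_less_trans)
    then have "((\<lambda>_. 0 :: real) has_real_derivative coeff D i) (at s0)"
      using P by (metis poly_has_deriv_def)
    then show ?thesis
      using DERIV_const DERIV_unique by blast
  qed
  then have degD: "degree D \<le> N"
    using degree_le by blast
  have ev: "eventually (\<lambda>s. L s (P s) = (\<Sum>i\<le>N. coeff (P s) i * L s (monom 1 i))) (nhds s0)"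
    using L
  proof eventually_elim
    case (elim s)
    then show ?case using even_positive_functional.mult_eq_sum[OF elim deg, where q = 1] by simp
  qed
  have "((\<lambda>s. \<Sum>i\<le>N. coeff (P s) i * L s (monom 1 i)) has_real_derivative
     (\<Sum>i\<le>N. coeff D i * L s0 (monom 1 i) + (- L s0 (r * monom 1 i)) * coeff (P s0) i)) (at s0)"
    using P L' unfolding poly_has_deriv_def by (intro DERIV_sum DERIV_mult) auto
  also have "(\<Sum>i\<le>N. coeff D i * L s0 (monom 1 i) + (- L s0 (r * monom 1 i)) * coeff (P s0) i)
      = L s0 D - L s0 (r * P s0)"
    using mult_eq_sum[OF degD, where q = 1] mult_eq_sum[OF deg, where q = r]
    by (simp add: sum_subtractf mult.commute)
  finally show ?thesis
    using ev by (subst DERIV_cong_ev[OF refl _ refl])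
qed

text \<open>Induction along the recurrence; positivity of the norms permits the quotient
  rule.\<close>

lemma op_seq_has_deriv:
  assumes L: "eventually (\<lambda>s. even_positive_functional (L s)) (nhds s0)"
    and L': "\<And>p. ((\<lambda>s. L s p) has_real_derivative - L s0 (r * p)) (at s0)"
  shows "\<exists>D. poly_has_deriv (\<lambda>s. op_seq (L s) n) D s0"
proof (induction "L s0" n rule: op_seq.induct)
  case (3 n)
  interpret even_positive_functional "L s0"
    using L by (rule eventually_nhds_x_imp_x)
  obtain D E where D: "poly_has_deriv (\<lambda>s. op_seq (L s) (Suc n)) D s0"
    and E: "poly_has_deriv (\<lambda>s. op_seq (L s) n) E s0"
    using 3 by blast
  have deg: "degree (op_seq (L s) i * op_seq (L s) i) \<le> i + i" for i s
    by (simp add: degree_mult_eq)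
  have "L s0 (op_seq (L s0) n * op_seq (L s0) n) \<noteq> 0"
    using pos[of "op_seq (L s0) n"] by simp
  then show ?case
    using poly_has_deriv_diff[OF poly_has_deriv_mult[OF poly_has_deriv_const D]
      poly_has_deriv_smult[OF DERIV_divide[OF
        functional_has_deriv[OF L L' poly_has_deriv_mult[OF D D] deg]
        functional_has_deriv[OF L L' poly_has_deriv_mult[OF E E] deg]] E]]
    unfolding op_seq.simps by blast
qed (auto intro: poly_has_deriv_const)

lemma op_seq_norm_has_deriv:
  assumes L: "eventually (\<lambda>s. even_positive_functional (L s)) (nhds s0)"
    and L': "\<And>p. ((\<lambda>s. L s p) has_real_derivative - L s0 (r * p)) (at s0)"
  shows "((\<lambda>s. L s (op_seq (L s) n * op_seq (L s) n)) has_real_derivative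
           - L s0 (r * (op_seq (L s0) n * op_seq (L s0) n))) (at s0)"
proof -
  interpret even_positive_functional "L s0"
    using L by (rule eventually_nhds_x_imp_x)
  obtain D where D: "poly_has_deriv (\<lambda>s. op_seq (L s) n) D s0"
    using op_seq_has_deriv[OF L L'] by blast
  \<comment> \<open>The leading coefficient is constantly 1, so even index \<open>n\<close>
    contributes nothing.\<close>
  have "coeff D i = 0" if "i \<ge> n" for i
  proof -
    have "(\<lambda>s. coeff (op_seq (L s) n) i) = (\<lambda>_. if i = n then 1 else 0)"
      using that by (auto simp: coeff_eq_0)
    then have "((\<lambda>_. if i = n then 1 else 0 :: real) has_real_derivative coeff D i) (at s0)"
      using D by (metis poly_has_deriv_def)
    then show ?thesis
      using DERIV_const DERIV_unique by blast
  qed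
  then have "L s0 (op_seq (L s0) n * D) = 0"
    by (rule op_seq_orthogonal_lower)
  then have "L s0 (D * op_seq (L s0) n + op_seq (L s0) n * D) = 0"
    by (subst add) (simp add: mult.commute[of D])
  moreover have deg: "degree (op_seq (L s) n * op_seq (L s) n) \<le> n + n" for s
    by (simp add: degree_mult_eq)
  ultimately show ?thesis
    using functional_has_deriv[OF L L' poly_has_deriv_mult[OF D D] deg] by simp
qed

section \<open>The moment functional of the weight\<close>

lemma integrable_abs_powr_exp:
  fixes a :: real
  assumes "a > -1"
  shows "integrable lborel (\<lambda>x::real. \<bar>x\<bar> powr a * exp (- \<bar>x\<bar>))"
proof -
  define g where "g = (\<lambda>x::real. indicator {0..} x * x powr a / exp x)"
  have "(\<integral>\<^sup>+ x. ennreal (g x) \<partial>lborel) = Gamma (a + 1)"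
    using Gamma_conv_nn_integral_real[of "a + 1"] assms by (simp add: g_def)
  then have g: "integrable lborel g"
    by (intro integrableI_nonneg) (auto simp: g_def)
  \<comment> \<open>The Gamma integrand and its reflection cover the line; both are 0 at the origin,
    since \<open>0 powr a = 0\<close>.\<close>
  then have "integrable lborel (\<lambda>x. g x + g (0 + (-1) * x))"
    by (intro Bochner_Integration.integrable_add lborel_integrable_real_affine) auto
  also have "(\<lambda>x. g x + g (0 + (-1) * x)) = (\<lambda>x. \<bar>x\<bar> powr a * exp (- \<bar>x\<bar>))"
    by (auto simp: g_def fun_eq_iff indicator_def exp_minus divide_simps)
  finally show ?thesis .
qed

text \<open>The top term dominates for large \<open>\<bar>x\<bar>\<close> and the sum is bounded
  elsewhere; this allows comparison of the weight with \<open>exp (- \<bar>x\<bar>)\<close>.\<close>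

lemma exponent_lower_bound:
  fixes t :: "nat \<Rightarrow> real"
  assumes "m \<ge> 1" "t m > 0"
  shows "\<exists>C. \<forall>x. \<bar>x\<bar> - C \<le> (\<Sum>k=1..m. t k * x ^ (2 * k))"
proof -
  define A where "A = (\<Sum>k=1..<m. \<bar>t k\<bar>)"
  \<comment> \<open>Chosen so that \<open>t m * x\<^sup>2 - A \<ge> \<bar>x\<bar>\<close> and powers
    of \<open>\<bar>x\<bar>\<close> increase with the exponent once
    \<open>\<bar>x\<bar> \<ge> R\<close>.\<close>
  define R where "R = max 1 ((A + 1) / t m)"
  define B where "B = (\<Sum>k=1..m. \<bar>t k\<bar> * R ^ (2 * k))"
  have A: "A \<ge> 0" by (auto simp: A_def intro: sum_nonneg)
  have B: "B \<ge> 0" by (auto simp: B_def R_def intro!: sum_nonneg)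
  have R: "R \<ge> 1" "(A + 1) \<le> R * t m"
    using assms by (auto simp: R_def max_def field_simps)
  have "\<bar>x\<bar> - (R + B) \<le> (\<Sum>k=1..m. t k * x ^ (2 * k))" for x
  proof (cases "\<bar>x\<bar> \<le> R")
    case True
    have "\<bar>\<Sum>k=1..m. t k * x ^ (2 * k)\<bar> \<le> (\<Sum>k=1..m. \<bar>t k * x ^ (2 * k)\<bar>)"
      by (rule sum_abs)
    also have "\<dots> \<le> B"
      unfolding B_def abs_mult power_abs using True
      by (intro sum_mono mult_left_mono power_mono) auto
    finally show ?thesis using True by linarith
  next
    case False
    then have x: "1 \<le> \<bar>x\<bar>" "R \<le> \<bar>x\<bar>" using R by auto
    \<comment> \<open>Common factor: the lower terms total at most \<open>A * ?z\<close>, and the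
      top term is \<open>t m * x\<^sup>2 * ?z\<close>.\<close>
    let ?z = "x ^ (2 * (m - 1))"
    have z: "1 \<le> ?z"
      using x one_le_power[of "\<bar>x\<bar>" "2 * (m - 1)"] by (simp add: power_abs power_even_abs)
    have "\<bar>\<Sum>k=1..<m. t k * x ^ (2 * k)\<bar> \<le> (\<Sum>k=1..<m. \<bar>t k * x ^ (2 * k)\<bar>)"
      by (rule sum_abs)
    also have "\<dots> \<le> (\<Sum>k=1..<m. \<bar>t k\<bar> * \<bar>x\<bar> ^ (2 * (m - 1)))"
      unfolding abs_mult power_abs using x
      by (intro sum_mono mult_left_mono power_increasing) auto
    also have "\<dots> = A * ?z"
      by (simp add: A_def sum_distrib_right power_even_abs)
    finally have *: "- (A * ?z) \<le> (\<Sum>k=1..<m. t k * x ^ (2 * k))" by linarith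
    have "(A + 1) * \<bar>x\<bar> \<le> (R * t m) * \<bar>x\<bar>"
      using R by (intro mult_right_mono) auto
    also have "\<dots> \<le> t m * \<bar>x\<bar> * \<bar>x\<bar>"
      using x assms by (simp add: mult.commute mult_left_mono)
    finally have "(A + 1) * \<bar>x\<bar> \<le> t m * x\<^sup>2" by (simp add: power2_eq_square)
    moreover have "A \<le> A * \<bar>x\<bar>" using A x by (simp add: mult_le_cancel_left1)
    ultimately have "\<bar>x\<bar> \<le> t m * x\<^sup>2 - A" by (simp add: algebra_simps)
    then have "1 * \<bar>x\<bar> \<le> ?z * (t m * x\<^sup>2 - A)"
      using z by (intro mult_mono) auto
    also have "\<dots> = - (A * ?z) + t m * x ^ (2 * m)"
      using assms(1) by (cases m) (auto simp: algebra_simps power2_eq_square)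
    also have "\<dots> \<le> (\<Sum>k=1..<m. t k * x ^ (2 * k)) + t m * x ^ (2 * m)"
      using * by simp
    also have "\<dots> = (\<Sum>k=1..m. t k * x ^ (2 * k))"
      using assms(1) by (simp add: sum.last_plus)
    finally show ?thesis using R B by simp
  qed
  then show ?thesis by blast
qed

lemma weight_nonneg: "weight m t lam x \<ge> 0"
  by (simp add: weight_def)

lemma weight_pos: "x \<noteq> 0 \<Longrightarrow> weight m t lam x > 0"
  by (simp add: weight_def)

lemma weight_minus: "weight m t lam (- x) = weight m t lam x"
  by (simp add: weight_def)

lemma borel_measurable_weight [measurable]: "weight m t lam \<in> borel_measurable borel"
  unfolding weight_def by measurable

lemma borel_measurable_poly [measurable]: "poly (p :: real poly) \<in> borel_measurable borel"
  by (intro borel_measurable_continuous_onI continuous_intros)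

lemma weight_fun_upd:
  assumes "k \<in> {1..m}"
  shows "weight m (t(k := s)) lam x = weight m t lam x * exp (- ((s - t k) * x ^ (2 * k)))"
proof -
  have "(\<Sum>i=1..m. (t(k := s)) i * x ^ (2 * i)) =
      (\<Sum>i=1..m. t i * x ^ (2 * i) + (if i = k then (s - t k) * x ^ (2 * k) else 0))"
    by (intro sum.cong) (auto simp: algebra_simps)
  also have "\<dots> = (\<Sum>i=1..m. t i * x ^ (2 * i)) + (s - t k) * x ^ (2 * k)"
    using assms by (simp add: sum.distrib)
  finally show ?thesis
    by (simp only: weight_def minus_add_distrib exp_add mult.assoc)
qed

section \<open>The moment functional and its positivity\<close>

definition weight_functional :: "nat \<Rightarrow> (nat \<Rightarrow> real) \<Rightarrow> real \<Rightarrow> real poly \<Rightarrow> real" where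
  "weight_functional m t lam p = (LINT x|lborel. poly p x * weight m t lam x)"

locale admissible_weight =
  fixes m :: nat and t :: "nat \<Rightarrow> real" and lam :: real
  assumes m: "m \<ge> 1" and tm: "t m > 0" and lam: "lam > -1"
begin

lemma weight_bound: "\<exists>C>0. \<forall>x. weight m t lam x \<le> C * (\<bar>x\<bar> powr (2 * lam + 1) * exp (- \<bar>x\<bar>))"
proof -
  obtain C where C: "\<And>x. \<bar>x\<bar> - C \<le> (\<Sum>k=1..m. t k * x ^ (2 * k))"
    using exponent_lower_bound[of m t, OF m tm] by blast
  have "weight m t lam x \<le> exp C * (\<bar>x\<bar> powr (2 * lam + 1) * exp (- \<bar>x\<bar>))" for x
  proof -
    have "weight m t lam x \<le> \<bar>x\<bar> powr (2 * lam + 1) * exp (C - \<bar>x\<bar>)"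
      unfolding weight_def using C[of x] by (intro mult_left_mono) auto
    then show ?thesis by (simp add: exp_diff exp_minus field_simps)
  qed
  then show ?thesis by (intro exI[of _ "exp C"]) auto
qed

lemma integrable_power_weight: "integrable lborel (\<lambda>x. x ^ j * weight m t lam x)"
proof -
  obtain C where C: "C > 0"
    "\<And>x. weight m t lam x \<le> C * (\<bar>x\<bar> powr (2 * lam + 1) * exp (- \<bar>x\<bar>))"
    using weight_bound by blast
  have bound: "norm (x ^ j * weight m t lam x)
      \<le> norm (C * (\<bar>x\<bar> powr (2 * lam + 1 + real j) * exp (- \<bar>x\<bar>)))" for x
  proof (cases "x = 0")
    case True
    then show ?thesis by (simp add: weight_def)
  next
    case False
    have "norm (x ^ j * weight m t lam x) = \<bar>x\<bar> ^ j * weight m t lam x"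
      by (simp add: abs_mult power_abs weight_nonneg)
    also have "\<dots> \<le> \<bar>x\<bar> ^ j * (C * (\<bar>x\<bar> powr (2 * lam + 1) * exp (- \<bar>x\<bar>)))"
      by (intro mult_left_mono C) auto
    also have "\<dots> = C * (\<bar>x\<bar> powr (2 * lam + 1 + real j) * exp (- \<bar>x\<bar>))"
      using False by (simp add: powr_add powr_realpow)
    finally show ?thesis by simp
  qed
  have "integrable lborel (\<lambda>x. C * (\<bar>x\<bar> powr (2 * lam + 1 + real j) * exp (- \<bar>x\<bar>)))"
    using lam by (intro integrable_mult_right integrable_abs_powr_exp) auto
  then show ?thesis
    by (rule Bochner_Integration.integrable_bound) (use bound in auto)
qed

lemma integrable_poly_weight: "integrable lborel (\<lambda>x. poly p x * weight m t lam x)"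
  unfolding poly_altdef sum_distrib_right mult.assoc
  by (intro Bochner_Integration.integrable_sum integrable_mult_right integrable_power_weight)

sublocale even_positive_functional "weight_functional m t lam"
proof
  fix p q :: "real poly" and c :: real
  show "weight_functional m t lam (p + q) = weight_functional m t lam p + weight_functional m t lam q"
    by (simp add: weight_functional_def algebra_simps integrable_poly_weight
      flip: Bochner_Integration.integral_add)
  show "weight_functional m t lam (smult c p) = c * weight_functional m t lam p"
    by (simp add: weight_functional_def mult.assoc)
  show "weight_functional m t lam p = 0" if "pcompose p [:0, -1:] = - p"
  proof -
    have "poly p (- x) = - poly p x" for x
      using arg_cong[OF that, of "\<lambda>q. poly q x"] by (simp add: poly_pcompose)
    \<comment> \<open>Substitution of \<open>- x\<close> for \<open>x\<close>.\<close>
    then have "weight_functional m t lam p = - weight_functional m t lam p"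
      unfolding weight_functional_def
      by (subst lborel_integral_real_affine[of "-1" _ 0]) (simp_all add: weight_minus)
    then show ?thesis by simp
  qed
  show "weight_functional m t lam (p * p) > 0" if "p \<noteq> 0"
  proof -
    have nonneg: "poly (p * p) x * weight m t lam x \<ge> 0" for x
      by (simp add: weight_nonneg)
    \<comment> \<open>The integrand is positive off the roots of \<open>p\<close> and the origin,
      where the weight is 0 by convention; this finite set is null.\<close>
    have "\<not> (AE x in lborel. poly (p * p) x * weight m t lam x = 0)"
    proof
      assume "AE x in lborel. poly (p * p) x * weight m t lam x = 0"
      moreover have "finite (insert 0 {x. poly p x = 0})"
        using that by (simp add: poly_roots_finite)
      then have "AE x in lborel. x \<notin> insert 0 {x. poly p x = 0}"
        by (intro AE_not_in finite_imp_null_set_lborel)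
      ultimately have "AE x::real in lborel. False"
        by eventually_elim (auto dest: weight_pos[of _ m t lam])
      then show False by (simp add: eventually_False ae_filter_eq_bot_iff)
    qed
    then have "weight_functional m t lam (p * p) \<noteq> 0"
      unfolding weight_functional_def
      using integral_nonneg_eq_0_iff_AE[OF integrable_poly_weight[of "p * p"]] nonneg by auto
    moreover have "weight_functional m t lam (p * p) \<ge> 0"
      unfolding weight_functional_def using nonneg by (rule Bochner_Integration.integral_nonneg)
    ultimately show ?thesis by simp
  qed
qed

end

section \<open>Two elementary exponential estimates\<close>

lemma abs_exp_minus_one_le: "\<bar>exp u - 1\<bar> \<le> \<bar>u\<bar> * exp \<bar>u\<bar>" for u :: real
proof (cases "u \<ge> 0")
  case True
  have "(1 - u) * exp u \<le> exp (- u) * exp u"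
    using exp_ge_add_one_self[of "- u"] by (intro mult_right_mono) auto
  then show ?thesis using True by (simp add: algebra_simps flip: exp_add)
next
  case False
  have "\<bar>u\<bar> * 1 \<le> \<bar>u\<bar> * exp \<bar>u\<bar>" by (intro mult_left_mono) auto
  moreover have "\<bar>exp u - 1\<bar> = 1 - exp u" using False by simp
  ultimately show ?thesis using False exp_ge_add_one_self[of u] by linarith
qed

lemma tendsto_powr_exp_at_top: "((\<lambda>x::real. x powr a * exp (- x)) \<longlongrightarrow> 0) at_top"
proof (rule Lim_null_comparison)
  show "((\<lambda>x::real. x ^ nat \<lceil>a\<rceil> / exp x) \<longlongrightarrow> 0) at_top"
    by (rule tendsto_power_div_exp_0)
  show "eventually (\<lambda>x::real. norm (x powr a * exp (- x)) \<le> x ^ nat \<lceil>a\<rceil> / exp x) at_top"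
    using eventually_ge_at_top[of 1]
  proof eventually_elim
    case (elim x)
    have "x powr a \<le> x powr real (nat \<lceil>a\<rceil>)"
      using elim by (intro powr_mono) linarith+
    then show ?case using elim by (simp add: powr_realpow exp_minus field_simps)
  qed
qed

section \<open>Differentiation of the functional in one parameter\<close>

context admissible_weight
begin

lemma admissible_weight_fun_upd:
  assumes "k = m \<Longrightarrow> s > 0"
  shows "admissible_weight m (t(k := s)) lam"
  using m tm lam assms by unfold_locales auto

text \<open>Dominated convergence of the difference quotients, along sequences because that theorem
  is sequential.\<close>

lemma weight_functional_has_deriv:
  assumes k: "k \<in> {1..m}"
  shows "((\<lambda>s. weight_functional m (t(k := s)) lam p) has_real_derivative
           - weight_functional m t lam (monom 1 (2 * k) * p)) (at (t k))"
  unfolding has_field_derivative_iff tendsto_at_iff_sequentially comp_def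
proof (intro allI impI)
  fix X :: "nat \<Rightarrow> real"
  assume X: "\<forall>i. X i \<in> UNIV - {t k}" "X \<longlonglongrightarrow> t k"
  \<comment> \<open>Small enough that lowering \<open>t k\<close> by \<open>\<delta>\<close> stays
    admissible even for \<open>k = m\<close>; the lowered weight supplies the dominating
    function.\<close>
  define \<delta> where "\<delta> = t m / 2"
  have \<delta>: "\<delta> > 0" "\<delta> < t m" using tm by (auto simp: \<delta>_def)
  let ?w = "weight m t lam"
  let ?D = "\<lambda>s x. poly p x * ((weight m (t(k := s)) lam x - ?w x) / (s - t k))"
  interpret low: admissible_weight m "t(k := t k - \<delta>)" lam
    by (rule admissible_weight_fun_upd) (use \<delta> in auto)
  obtain N where N: "\<And>i. i \<ge> N \<Longrightarrow> \<bar>X i - t k\<bar> < \<delta>"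
    using LIMSEQ_D[OF X(2) \<delta>(1)] by (auto simp: real_norm_def)
  have adm: "admissible_weight m (t(k := X (i + N))) lam" for i
    by (rule admissible_weight_fun_upd) (use N[of "i + N"] \<delta> in auto)
  \<comment> \<open>The estimate for \<open>exp u - 1\<close> gives at most
    \<open>y * exp (\<delta> * y)\<close> for the quotient of exponentials, and
    \<open>exp (\<delta> * y)\<close> turns the weight into the one at
    \<open>t k - \<delta>\<close>.\<close>
  have bound: "norm (?D (X (i + N)) x)
      \<le> \<bar>poly (monom 1 (2 * k) * p) x\<bar> * weight m (t(k := t k - \<delta>)) lam x" for i x
  proof -
    define h where "h = X (i + N) - t k"
    define y where "y = x ^ (2 * k)"
    have y: "y \<ge> 0" by (simp add: y_def)
    have h: "\<bar>h\<bar> \<le> \<delta>" "h \<noteq> 0" using N[of "i + N"] X(1) by (auto simp: h_def less_imp_le)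
    have "\<bar>exp (- (h * y)) - 1\<bar> \<le> \<bar>h * y\<bar> * exp \<bar>h * y\<bar>"
      using abs_exp_minus_one_le[of "- (h * y)"] by simp
    also have "\<dots> \<le> \<bar>h * y\<bar> * exp (\<delta> * y)"
      using h y by (intro mult_left_mono) (auto simp: abs_mult mult_right_mono)
    finally have "\<bar>exp (- (h * y)) - 1\<bar> / \<bar>h\<bar> \<le> y * exp (\<delta> * y)"
      using h y by (simp add: abs_mult divide_simps mult_ac)
    then have "\<bar>poly p x\<bar> * ?w x * (\<bar>exp (- (h * y)) - 1\<bar> / \<bar>h\<bar>)
        \<le> \<bar>poly p x\<bar> * ?w x * (y * exp (\<delta> * y))"
      by (intro mult_left_mono) (auto simp: weight_nonneg)
    moreover have "?D (X (i + N)) x = poly p x * ?w x * ((exp (- (h * y)) - 1) / h)"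
      using k by (simp add: weight_fun_upd h_def y_def right_diff_distrib)
    ultimately show ?thesis
      using k y by (simp add: weight_fun_upd abs_mult poly_monom weight_nonneg flip: y_def)
        (simp add: mult_ac)
  qed
  have lim: "(\<lambda>i. ?D (X (i + N)) x) \<longlonglongrightarrow> - (poly (monom 1 (2 * k) * p) x * ?w x)" for x
  proof -
    have "((\<lambda>s. weight m (t(k := s)) lam x) has_real_derivative - (x ^ (2 * k) * ?w x)) (at (t k))"
      unfolding weight_fun_upd[OF k] by (auto intro!: derivative_eq_intros)
    then have "(\<lambda>i. (weight m (t(k := X i)) lam x - ?w x) / (X i - t k))
        \<longlonglongrightarrow> - (x ^ (2 * k) * ?w x)"
      using X unfolding has_field_derivative_iff tendsto_at_iff_sequentially comp_def by simp
    from tendsto_mult[OF tendsto_const[of "poly p x"] LIMSEQ_ignore_initial_segment[OF this, of N]]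
    show ?thesis by (simp add: poly_monom mult_ac)
  qed
  have "(\<lambda>i. LINT x|lborel. ?D (X (i + N)) x) \<longlonglongrightarrow>
      (LINT x|lborel. - (poly (monom 1 (2 * k) * p) x * ?w x))"
  proof (rule integral_dominated_convergence)
    show "integrable lborel
        (\<lambda>x. \<bar>poly (monom 1 (2 * k) * p) x\<bar> * weight m (t(k := t k - \<delta>)) lam x)"
      using integrable_abs[OF low.integrable_poly_weight[of "monom 1 (2 * k) * p"]]
      by (simp only: abs_mult abs_of_nonneg[OF weight_nonneg])
  qed (use lim bound in auto)
  moreover have "(LINT x|lborel. ?D (X (i + N)) x) =
      (weight_functional m (t(k := X (i + N))) lam p - weight_functional m (t(k := t k)) lam p)
        / (X (i + N) - t k)" for i
    using integrable_poly_weight[of p] admissible_weight.integrable_poly_weight[OF adm, of p i]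
    by (simp add: weight_functional_def right_diff_distrib diff_divide_distrib)
  ultimately have "(\<lambda>i. (weight_functional m (t(k := X (i + N))) lam p
      - weight_functional m (t(k := t k)) lam p) / (X (i + N) - t k))
      \<longlonglongrightarrow> - weight_functional m t lam (monom 1 (2 * k) * p)"
    by (simp only: weight_functional_def Bochner_Integration.integral_minus)
  then show "(\<lambda>i. (weight_functional m (t(k := X i)) lam p
      - weight_functional m (t(k := t k)) lam p) / (X i - t k))
      \<longlonglongrightarrow> - weight_functional m t lam (monom 1 (2 * k) * p)"
    by (rule LIMSEQ_offset)
qed

section \<open>Integration by parts: the Pearson identity\<close>

text \<open>Defined so that \<open>pearson_poly p * w\<close> is the derivative of
  \<open>x * p * w\<close> away from the origin.\<close>

definition pearson_poly :: "real poly \<Rightarrow> real poly" where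
  "pearson_poly p = smult (2 * lam + 2) p + [:0, 1:] * pderiv p
     - (\<Sum>k=1..m. smult (2 * real k * t k) (monom 1 (2 * k) * p))"

text \<open>Fundamental theorem of calculus for \<open>x * p * w\<close>. The half line avoids the
  possible singularity of the weight at 0.\<close>

lemma pearson_half_line:
  "(LINT x:{0<..}|lborel. poly (pearson_poly p) x * weight m t lam x) = 0"
proof -
  define E where "E = (\<lambda>x::real. exp (- (\<Sum>k=1..m. t k * x ^ (2 * k))))"
  \<comment> \<open>This is \<open>x * p * w\<close> for \<open>x > 0\<close>, with the factor
    \<open>x\<close> absorbed into the power; the exponent \<open>2 * lam + 2\<close> is positive,
    so \<open>F\<close> tends to 0 at 0.\<close>
  define F where "F = (\<lambda>x. poly p x * (x powr (2 * lam + 2) * E x))"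
  let ?f = "\<lambda>x. poly (pearson_poly p) x * weight m t lam x"
  have weight: "x * weight m t lam x = x powr (2 * lam + 2) * E x" if "x > 0" for x
    using that powr_add[of x 1 "2 * lam + 1"] by (simp add: weight_def E_def add.commute)
  have deriv: "(F has_real_derivative ?f x) (at x)" if "x > 0" for x
  proof -
    define V' where "V' = (\<Sum>k=1..m. t k * (real (2 * k) * x ^ (2 * k - Suc 0)))"
    have "((\<lambda>x. \<Sum>k=1..m. t k * x ^ (2 * k)) has_real_derivative V') (at x)"
      unfolding V'_def by (intro DERIV_sum DERIV_cmult DERIV_pow)
    then have E': "(E has_real_derivative E x * - V') (at x)"
      unfolding E_def by (intro DERIV_fun_exp DERIV_minus)
    have V': "x * V' = (\<Sum>k=1..m. 2 * real k * t k * x ^ (2 * k))"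
      unfolding sum_distrib_left V'_def
    proof (intro sum.cong refl)
      fix k assume "k \<in> {1..m}"
      then show "x * (t k * (real (2 * k) * x ^ (2 * k - Suc 0))) = 2 * real k * t k * x ^ (2 * k)"
        by (cases k) (auto simp: algebra_simps)
    qed
    define u where "u = x powr (2 * lam + 1)"
    have u: "x powr (2 * lam + 2) = x * u"
      using that powr_add[of x 1 "2 * lam + 1"] by (simp add: u_def add.commute)
    have "((\<lambda>x. x powr (2 * lam + 2)) has_real_derivative (2 * lam + 2) * x powr (2 * lam + 2 - 1)) (at x)"
      using that by (rule has_real_derivative_powr)
    also have "2 * lam + 2 - 1 = 2 * lam + 1" by simp
    finally have P: "((\<lambda>x. x powr (2 * lam + 2)) has_real_derivative (2 * lam + 2) * u) (at x)"
      unfolding u_def .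
    have "(F has_real_derivative poly (pderiv p) x * (x powr (2 * lam + 2) * E x)
        + ((2 * lam + 2) * u * E x + E x * - V' * x powr (2 * lam + 2)) * poly p x) (at x)"
      unfolding F_def by (intro DERIV_mult P E' poly_DERIV)
    also have "poly (pderiv p) x * (x powr (2 * lam + 2) * E x)
        + ((2 * lam + 2) * u * E x + E x * - V' * x powr (2 * lam + 2)) * poly p x
       = ((2 * lam + 2) * poly p x + x * poly (pderiv p) x - x * V' * poly p x) * (u * E x)"
      unfolding u by (simp add: algebra_simps)
    also have "u * E x = weight m t lam x"
      using that by (simp add: weight_def u_def E_def)
    also have "((2 * lam + 2) * poly p x + x * poly (pderiv p) x - x * V' * poly p x)
        = poly (pearson_poly p) x"
      unfolding V' by (simp add: pearson_poly_def poly_sum poly_monom sum_distrib_right mult.assoc)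
    finally show ?thesis .
  qed
  have cont: "isCont ?f x" if "x > 0" for x
    unfolding weight_def using that by (intro continuous_intros) auto
  have int: "set_integrable lborel {0<..} ?f"
    unfolding set_integrable_def by (intro integrable_mult_indicator integrable_poly_weight) auto
  have zero: "(F \<longlongrightarrow> 0) (at_right 0)"
  proof -
    have "((\<lambda>x::real. x powr (2 * lam + 2)) \<longlongrightarrow> 0) (at_right 0)"
    proof (rule tendsto_zero_powrI)
      show "eventually (\<lambda>x::real. x \<ge> 0) (at_right 0)"
        using eventually_at_right_less[of 0] by eventually_elim simp
    qed (use lam in \<open>auto intro: tendsto_intros\<close>)
    moreover have "(E \<longlongrightarrow> E 0) (at_right 0)"
      unfolding E_def by (intro tendsto_intros)
    moreover have "(poly p \<longlongrightarrow> poly p 0) (at_right 0)"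
      by (intro tendsto_intros)
    ultimately have "(F \<longlongrightarrow> poly p 0 * (0 * E 0)) (at_right 0)"
      unfolding F_def by (intro tendsto_mult)
    then show ?thesis by simp
  qed
  have infty: "(F \<longlongrightarrow> 0) at_top"
  proof -
    obtain C where C: "C > 0"
      "\<And>x. weight m t lam x \<le> C * (\<bar>x\<bar> powr (2 * lam + 1) * exp (- \<bar>x\<bar>))"
      using weight_bound by blast
    \<comment> \<open>Majorant from expanding \<open>p\<close> into monomials and using
      \<open>weight_bound\<close>; each term decays at infinity.\<close>
    define G where "G = (\<lambda>x::real. \<Sum>i\<le>degree p. \<bar>coeff p i\<bar> * C * (x powr (2 * lam + 2 + real i) * exp (- x)))"
    have "(G \<longlongrightarrow> (\<Sum>i\<le>degree p. \<bar>coeff p i\<bar> * C * 0)) at_top"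
      unfolding G_def by (intro tendsto_sum tendsto_mult tendsto_const tendsto_powr_exp_at_top)
    then have "(G \<longlongrightarrow> 0) at_top" by simp
    moreover have "eventually (\<lambda>x. norm (F x) \<le> G x) at_top"
      using eventually_gt_at_top[of 0]
    proof eventually_elim
      case (elim x)
      have "norm (F x) = \<bar>poly p x\<bar> * (x * weight m t lam x)"
        using elim by (simp add: F_def weight abs_mult) (simp add: E_def)
      also have "\<dots> \<le> (\<Sum>i\<le>degree p. \<bar>coeff p i\<bar> * x ^ i) *
          (x * (C * (\<bar>x\<bar> powr (2 * lam + 1) * exp (- \<bar>x\<bar>))))"
      proof (intro mult_mono C)
        have "\<bar>poly p x\<bar> \<le> (\<Sum>i\<le>degree p. \<bar>coeff p i * x ^ i\<bar>)"
          unfolding poly_altdef by (rule sum_abs)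
        then show "\<bar>poly p x\<bar> \<le> (\<Sum>i\<le>degree p. \<bar>coeff p i\<bar> * x ^ i)"
          using elim by (simp add: abs_mult)
      qed (use elim in \<open>auto simp: weight_nonneg intro!: sum_nonneg\<close>)
      also have "\<dots> = G x"
        unfolding G_def sum_distrib_right
      proof (intro sum.cong refl)
        fix i
        have "x powr (2 * lam + 2 + real i) = x ^ i * x * x powr (2 * lam + 1)"
          using elim powr_add[of x "2 * lam + 1" "1 + real i"] powr_add[of x 1 "real i"]
          by (simp add: powr_realpow algebra_simps)
        then show "\<bar>coeff p i\<bar> * x ^ i * (x * (C * (\<bar>x\<bar> powr (2 * lam + 1) * exp (- \<bar>x\<bar>))))
            = \<bar>coeff p i\<bar> * C * (x powr (2 * lam + 2 + real i) * exp (- x))"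
          using elim by simp
      qed
      finally show ?case .
    qed
    ultimately show ?thesis by (rule Lim_null_comparison[rotated])
  qed
  have "(LBINT x=0..\<infinity>. ?f x) = 0 - 0"
  proof (rule interval_integral_FTC_integrable[where F = F])
    show "((F \<circ> real_of_ereal) \<longlongrightarrow> 0) (at_right 0)"
      using zero by (simp add: zero_ereal_def ereal_tendsto_simps)
    show "((F \<circ> real_of_ereal) \<longlongrightarrow> 0) (at_left \<infinity>)"
      using infty by (simp add: ereal_tendsto_simps)
    show "set_integrable lborel (einterval 0 \<infinity>) ?f"
      using int by (simp add: zero_ereal_def)
  qed (use deriv cont in \<open>auto simp: has_real_derivative_iff_has_vector_derivative\<close>)
  then show ?thesis
    by (simp add: interval_lebesgue_integral_0_infty)
qed

text \<open>The negative half line is reflected onto the positive one, with \<open>p\<close>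
  replaced by its reflection.\<close>

lemma pearson: "weight_functional m t lam (pearson_poly p) = 0"
proof -
  let ?q = "pcompose p [:0, -1:]"
  let ?g = "\<lambda>p x. indicator {0<..} x *\<^sub>R (poly (pearson_poly p) x * weight m t lam x)"
  have int: "integrable lborel (?g p)" for p
    by (intro integrable_mult_indicator integrable_poly_weight) auto
  have zero: "integral\<^sup>L lborel (?g p) = 0" for p
    using pearson_half_line[of p] by (simp add: set_lebesgue_integral_def)
  \<comment> \<open>Reflection commutes with \<open>pearson_poly\<close>: both \<open>x d/dx\<close>
    and the even powers are invariant.\<close>
  have q: "poly (pearson_poly ?q) (- x) = poly (pearson_poly p) x" for x
    by (simp add: pearson_poly_def poly_pcompose poly_sum poly_monom pderiv_pcompose pderiv_pCons)
  have "weight_functional m t lam (pearson_poly p) =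
      (LINT x|lborel. ?g p x + ?g ?q (0 + (-1) * x))"
    unfolding weight_functional_def
    by (intro integral_cong_AE)
      (use AE_lborel_singleton[of 0] in \<open>auto simp: q weight_minus indicator_def elim!: eventually_mono\<close>)
  also have "\<dots> = integral\<^sup>L lborel (?g p) + (LINT x|lborel. ?g ?q (0 + (-1) * x))"
    by (intro Bochner_Integration.integral_add int lborel_integrable_real_affine) simp
  also have "(LINT x|lborel. ?g ?q (0 + (-1) * x)) = integral\<^sup>L lborel (?g ?q)"
    by (subst (2) lborel_integral_real_affine[of "-1" _ 0]) auto
  finally show ?thesis by (simp only: zero)
qed

section \<open>Norms, recurrence coefficients and their derivatives\<close>

abbreviation op :: "nat \<Rightarrow> real poly" where
  "op \<equiv> op_seq (weight_functional m t lam)"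

definition norm_sq :: "nat \<Rightarrow> real" where
  "norm_sq n = weight_functional m t lam (op n * op n)"

lemma norm_sq_pos: "norm_sq n > 0"
  by (simp add: norm_sq_def pos)

text \<open>Resolves the definite description: \<open>op\<close> is an orthogonal sequence, and
  \<open>op_seq_unique\<close> excludes others.\<close>

lemma monic_OP_eq: "monic_OP (weight m t lam) = op"
  unfolding monic_OP_def
proof (rule the_equality)
  have integral: "weight_functional m t lam (P i * P j)
      = (LINT x|lborel. poly (P i) x * poly (P j) x * weight m t lam x)" for P i j
    by (simp add: weight_functional_def)
  show "monic_orthogonal_seq (weight m t lam) op"
    unfolding monic_orthogonal_seq_def integral[symmetric]
    using op_seq_orthogonal norm_sq_pos integrable_poly_weight[of "op _ * op _"]
    by (simp add: norm_sq_def)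
  show "P = op" if "monic_orthogonal_seq (weight m t lam) P" for P
    using that unfolding monic_orthogonal_seq_def integral[symmetric]
    by (intro op_seq_unique) blast+
qed

text \<open>The recurrence is built into \<open>op_seq\<close>; its coefficient is unique because
  \<open>op (n - 1)\<close> is nonzero.\<close>

lemma beta_eq:
  assumes "n \<ge> 1"
  shows "beta m t lam n = norm_sq n / norm_sq (n - 1)"
proof -
  have eq: "[:0, 1:] * op n = op (n + 1) + smult (norm_sq n / norm_sq (n - 1)) (op (n - 1))"
    using X_mult_op_seq[of n] assms by (simp add: norm_sq_def)
  have "(THE b. [:0, 1:] * op n = op (n + 1) + smult b (op (n - 1))) = norm_sq n / norm_sq (n - 1)"
  proof (rule the_equality)
    show "[:0, 1:] * op n = op (n + 1) + smult (norm_sq n / norm_sq (n - 1)) (op (n - 1))"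
      by (fact eq)
  next
    fix b assume "[:0, 1:] * op n = op (n + 1) + smult b (op (n - 1))"
    with eq have "smult (b - norm_sq n / norm_sq (n - 1)) (op (n - 1)) = 0"
      by (simp add: smult_diff_left)
    then show "b = norm_sq n / norm_sq (n - 1)" by simp
  qed
  then show ?thesis
    using assms by (simp add: beta_def rec_coeff_def monic_OP_eq)
qed

text \<open>Integration by parts applied to \<open>p = op n * op n\<close>: as \<open>x (op n)' = n op n + (lower degree)\<close>,
  the derivative term contributes \<open>2 n\<close>.\<close>
lemma sum_moments_op:
  "(\<Sum>k=1..m. 2 * real k * t k * weight_functional m t lam (monom 1 (2 * k) * (op n * op n)))
    = (2 * lam + 2 + 2 * real n) * norm_sq n"
proof -
  let ?L = "weight_functional m t lam"
  define d where "d = [:0, 1:] * pderiv (op n) - smult (real n) (op n)"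
  have "coeff d i = 0" if "i \<ge> n" for i
    using that unfolding d_def
    by (cases i; cases "i = n") (auto simp: coeff_pderiv coeff_eq_0)
  then have "?L (op n * d) = 0"
    by (rule op_seq_orthogonal_lower)
  moreover have "[:0, 1:] * pderiv (op n * op n)
      = smult 2 (op n * d) + smult (2 * real n) (op n * op n)"
    by (simp add: d_def pderiv_mult poly_eq_poly_eq_iff[symmetric] fun_eq_iff algebra_simps)
  ultimately have "?L ([:0, 1:] * pderiv (op n * op n)) = 2 * real n * norm_sq n"
    by (simp only: add smult norm_sq_def)
  then show ?thesis
    using pearson[of "op n * op n"]
    by (simp only: pearson_poly_def diff add smult sum norm_sq_def) (simp add: algebra_simps)
qed

text \<open>Only \<open>k = m\<close> constrains \<open>s\<close>, and positivity is an open
  condition.\<close>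

lemma eventually_admissible_fun_upd:
  "eventually (\<lambda>s. admissible_weight m (t(k := s)) lam) (nhds (t k))"
proof -
  have "eventually (\<lambda>s. k = m \<longrightarrow> s > 0) (nhds (t k))"
  proof (cases "k = m")
    case True
    then show ?thesis
      using eventually_nhds_in_open[of "{0<..}" "t k"] tm by simp
  qed auto
  then show ?thesis
    by eventually_elim (auto intro: admissible_weight_fun_upd)
qed

lemma norm_sq_has_deriv:
  assumes "k \<in> {1..m}"
  shows "((\<lambda>s. admissible_weight.norm_sq m (t(k := s)) lam n) has_real_derivative
           - weight_functional m t lam (monom 1 (2 * k) * (op n * op n))) (at (t k))"
proof -
  have ev: "eventually (\<lambda>s. even_positive_functional (weight_functional m (t(k := s)) lam)) (nhds (t k))"
  using eventually_admissible_fun_upd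
  proof eventually_elim
    case (elim s)
    then interpret s: admissible_weight m "t(k := s)" lam .
    show ?case ..
  qed
  \<comment> \<open>The defining equation of \<open>norm_sq\<close> is available only for admissible
    parameters, hence only near \<open>t k\<close>.\<close>
  have eq: "eventually (\<lambda>s. admissible_weight.norm_sq m (t(k := s)) lam n =
      weight_functional m (t(k := s)) lam (op_seq (weight_functional m (t(k := s)) lam) n *
        op_seq (weight_functional m (t(k := s)) lam) n)) (nhds (t k))"
    using eventually_admissible_fun_upd by eventually_elim (rule admissible_weight.norm_sq_def)
  show ?thesis
    using op_seq_norm_has_deriv[OF ev, of "monom 1 (2 * k)" n] weight_functional_has_deriv[OF assms]
    by (subst DERIV_cong_ev[OF refl eq refl]) simp
qed

lemma ln_beta_has_deriv:
  assumes "k \<in> {1..m}" "n \<ge> 1"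
  shows "((\<lambda>s. ln (beta m (t(k := s)) lam n)) has_real_derivative
      weight_functional m t lam (monom 1 (2 * k) * (op (n - 1) * op (n - 1))) / norm_sq (n - 1)
      - weight_functional m t lam (monom 1 (2 * k) * (op n * op n)) / norm_sq n) (at (t k))"
proof -
  let ?h = "\<lambda>i s. admissible_weight.norm_sq m (t(k := s)) lam i"
  have ev: "eventually (\<lambda>s. ln (beta m (t(k := s)) lam n) = ln (?h n s) - ln (?h (n - 1) s)) (nhds (t k))"
    using eventually_admissible_fun_upd
  proof eventually_elim
    case (elim s)
    then interpret s: admissible_weight m "t(k := s)" lam .
    show ?case
      using s.norm_sq_pos[of n] s.norm_sq_pos[of "n - 1"] by (simp add: s.beta_eq[OF assms(2)] ln_div)
  qed
  have D: "((\<lambda>s. ln (?h i s)) has_real_derivative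
      1 / norm_sq i * - weight_functional m t lam (monom 1 (2 * k) * (op i * op i))) (at (t k))" for i
    using DERIV_chain2[OF DERIV_ln_divide norm_sq_has_deriv[OF assms(1)], of i] norm_sq_pos[of i]
    by simp
  show ?thesis
    using DERIV_diff[OF D[of n] D[of "n - 1"]] by (subst DERIV_cong_ev[OF refl ev refl]) simp
qed

end

text \<open>Positivity and differentiability are asserted as well, so that \<open>ln\<close> and
  \<open>deriv\<close> carry their usual meaning.\<close>

theorem corollary1:
  fixes m n :: nat and t :: "nat \<Rightarrow> real" and lam :: real
  assumes "m \<ge> 1" and "t m > 0" and "lam > -1" and "n \<ge> 1"
  shows "beta m t lam n > 0
    \<and> (\<forall>k\<in>{1..m}. (\<lambda>s. ln (beta m (t(k := s)) lam n)) differentiable (at (t k)))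
    \<and> (\<Sum>k=1..m. 2 * real k * t k * deriv (\<lambda>s. ln (beta m (t(k := s)) lam n)) (t k)) + 2 = 0"
proof -
  interpret admissible_weight m t lam
    using assms by unfold_locales
  note D = ln_beta_has_deriv[OF _ \<open>n \<ge> 1\<close>]
  let ?M = "\<lambda>k i. weight_functional m t lam (monom 1 (2 * k) * (op i * op i))"
  have "(\<Sum>k=1..m. 2 * real k * t k * deriv (\<lambda>s. ln (beta m (t(k := s)) lam n)) (t k))
      = (\<Sum>k=1..m. 2 * real k * t k * ?M k (n - 1) / norm_sq (n - 1)
          - 2 * real k * t k * ?M k n / norm_sq n)"
    by (intro sum.cong refl) (simp add: DERIV_imp_deriv[OF D] right_diff_distrib)
  \<comment> \<open>\<open>sum_moments_op\<close> at \<open>n - 1\<close> and at \<open>n\<close>;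
    the norms cancel.\<close>
  also have "\<dots> = (2 * lam + 2 + 2 * real (n - 1)) - (2 * lam + 2 + 2 * real n)"
    using norm_sq_pos[of n] norm_sq_pos[of "n - 1"]
    by (simp only: sum_subtractf sum_divide_distrib[symmetric] sum_moments_op) simp
  \<comment> \<open>Here \<open>n \<ge> 1\<close> makes the truncated \<open>n - 1\<close> a true
    predecessor.\<close>
  also have "\<dots> = - 2"
    using assms by simp
  finally have "(\<Sum>k=1..m. 2 * real k * t k * deriv (\<lambda>s. ln (beta m (t(k := s)) lam n)) (t k)) + 2 = 0"
    by simp
  moreover have "beta m t lam n > 0"
    using assms by (simp add: beta_eq norm_sq_pos)
  ultimately show ?thesis
    using D unfolding real_differentiable_def by blast
qed

end
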